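(* Let $J$ be an $SL(N,\mathbb{C})$-valued solution of the SDYM3 equation $F[J]\equiv D_{\bar y}(J^{-1}J_y)+D_z(J^{-1}J_z)=0$, and let $(Q^{(n)})_{n\in\mathbb{Z}}$ be a sequence of matrix-valued functions satisfying, for all $n\in\mathbb{Z}$, $$\hat A_y\big(J^{-1}Q^{(n)}\big)=D_z\big(J^{-1}Q^{(n+1)}\big),\qquad \hat A_z\big(J^{-1}Q^{(n)}\big)=-D_{\bar y}\big(J^{-1}Q^{(n+1)}\big).$$ Then for every $n\in\mathbb{Z}$ the conservation law $$(D_{\bar y}\hat A_y+D_z\hat A_z)\big(J^{-1}Q^{(n)}\big)=0$$ holds, i.e. $D_{\bar y}\big[\hat A_y(J^{-1}Q^{(n)})\big]+D_z\big[\hat A_z(J^{-1}Q^{(n)})\big]=0$, and each $Q^{(n)}$ is a symmetry characteristic of the SDYM3 equation.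
   Context: The independent variables are $y,z,\bar y$ (complex, treated as three independent variables). $D_y,D_z,D_{\bar y}$ are the total derivatives, also denoted by subscripts; they commute and satisfy the Leibniz rule. The covariant derivative operators act on matrix-valued functions $M$ by $$\hat A_yM=D_yM+[J^{-1}J_y,M],\qquad \hat A_zM=D_zM+[J^{-1}J_z,M],$$ where $[\cdot,\cdot]$ is the matrix commutator. A matrix-valued function $Q$ is a symmetry characteristic of SDYM3 if $(D_{\bar y}\hat A_y+D_z\hat A_z)(J^{-1}Q)=0$ for solutions $J$ of $F[J]=0$. This is the linearization of $F[J]=0$ in the direction $\delta J=\alpha Q$. *)

theory Defs
  imports "HOL-Analysis.Analysis"
begin

text \<open>
  Points of \<open>\<complex>\<^sup>3\<close> are triples \<open>(y, z, yb)\<close>; \<open>yb\<close> is the variable written \<open>y\<close>-bar, a third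
  independent complex variable and not the conjugate of \<open>y\<close>.  Fields are complex \<open>N \<times> N\<close> matrix
  valued, with \<open>N = CARD('n)\<close>, and are considered on an open set of points; their values elsewhere
  are irrelevant.
\<close>

type_synonym point = "complex \<times> complex \<times> complex"
type_synonym 'n mfield = "point \<Rightarrow> complex ^ 'n ^ 'n"

text \<open>
  Holomorphy in three variables: the Frechet derivative exists and is complex linear.
\<close>

definition holomorphic3_on :: "(point \<Rightarrow> complex) \<Rightarrow> point set \<Rightarrow> bool" where
  "holomorphic3_on f U \<longleftrightarrow>
     (\<forall>p\<in>U. \<exists>a b c. (f has_derivative (\<lambda>(h, k, l). a * h + b * k + c * l)) (at p within U))"

definition mfield_holomorphic_on :: "('n::finite) mfield \<Rightarrow> point set \<Rightarrow> bool" where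
  "mfield_holomorphic_on M U \<longleftrightarrow> (\<forall>i j. holomorphic3_on (\<lambda>p. M p $ i $ j) U)"

text \<open>
  On functions of the independent variables the total derivatives are the partial derivatives,
  taken entry by entry.
\<close>

definition D_y :: "('n::finite) mfield \<Rightarrow> 'n mfield" where
  "D_y M = (\<lambda>(y, z, yb). \<chi> i j. deriv (\<lambda>t. M (t, z, yb) $ i $ j) y)"

definition D_z :: "('n::finite) mfield \<Rightarrow> 'n mfield" where
  "D_z M = (\<lambda>(y, z, yb). \<chi> i j. deriv (\<lambda>t. M (y, t, yb) $ i $ j) z)"

definition D_yb :: "('n::finite) mfield \<Rightarrow> 'n mfield" where
  "D_yb M = (\<lambda>(y, z, yb). \<chi> i j. deriv (\<lambda>t. M (y, z, t) $ i $ j) yb)"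

definition commutator :: "complex ^ 'n ^ 'n \<Rightarrow> complex ^ 'n ^ 'n \<Rightarrow> complex ^ ('n::finite) ^ 'n" where
  "commutator A B = A ** B - B ** A"

definition inv_mult :: "('n::finite) mfield \<Rightarrow> 'n mfield \<Rightarrow> 'n mfield" where
  "inv_mult J M = (\<lambda>p. matrix_inv (J p) ** M p)"

definition cov_y :: "('n::finite) mfield \<Rightarrow> 'n mfield \<Rightarrow> 'n mfield" where
  "cov_y J M = (\<lambda>p. D_y M p + commutator (inv_mult J (D_y J) p) (M p))"

definition cov_z :: "('n::finite) mfield \<Rightarrow> 'n mfield \<Rightarrow> 'n mfield" where
  "cov_z J M = (\<lambda>p. D_z M p + commutator (inv_mult J (D_z J) p) (M p))"

definition sdym3 :: "('n::finite) mfield \<Rightarrow> 'n mfield" where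
  "sdym3 J = (\<lambda>p. D_yb (inv_mult J (D_y J)) p + D_z (inv_mult J (D_z J)) p)"

definition sdym3_solution :: "point set \<Rightarrow> ('n::finite) mfield \<Rightarrow> bool" where
  "sdym3_solution U J \<longleftrightarrow>
     mfield_holomorphic_on J U \<and> (\<forall>p\<in>U. invertible (J p)) \<and> (\<forall>p\<in>U. sdym3 J p = 0)"

definition SL_valued :: "point set \<Rightarrow> ('n::finite) mfield \<Rightarrow> bool" where
  "SL_valued U J \<longleftrightarrow> (\<forall>p\<in>U. det (J p) = 1)"

definition sdym3_lin :: "('n::finite) mfield \<Rightarrow> 'n mfield \<Rightarrow> 'n mfield" where
  "sdym3_lin J M = (\<lambda>p. D_yb (cov_y J M) p + D_z (cov_z J M) p)"

text \<open>
  A characteristic is taken at a given solution \<open>J\<close>, so that \<open>Q\<close> is a function of the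
  independent variables (its possible dependence on \<open>J\<close> being already evaluated).
\<close>

definition symmetry_characteristic :: "point set \<Rightarrow> ('n::finite) mfield \<Rightarrow> 'n mfield \<Rightarrow> bool" where
  "symmetry_characteristic U J Q \<longleftrightarrow>
     sdym3_solution U J \<and> mfield_holomorphic_on Q U \<and>
     (\<forall>p\<in>U. sdym3_lin J (inv_mult J Q) p = 0)"

end

theory Submission
  imports Defs "HOL-Complex_Analysis.Cauchy_Integral_Formula"
begin

text \<open>
  By the recursion, \<open>cov_y J (J\<^sup>-\<^sup>1 Q\<^sup>n)\<close> and \<open>cov_z J (J\<^sup>-\<^sup>1 Q\<^sup>n)\<close> are, up to sign, the partial
  derivatives with respect to \<open>z\<close> and \<open>yb\<close> of the single potential \<open>J\<^sup>-\<^sup>1 Q\<^sup>n\<^sup>+\<^sup>1\<close>, so the conservation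
  law is the equality of its mixed partial derivatives.  The potential is holomorphic by Cramer's
  rule.  The difference quotients of a bounded, separately holomorphic function in one variable
  converge uniformly in the other, by Cauchy's estimate of the second derivative; hence the limit
  may be differentiated in the other variable, which gives the equality of mixed partials.
\<close>

section \<open>One complex variable at a time: difference quotients and mixed partials\<close>

text \<open>The error is the first-order Taylor remainder divided by \<open>h\<close>. The bound
  sees \<open>f\<close> only through \<open>B\<close>, hence is uniform over a family of functions
  with a common bound.\<close>

lemma difference_quotient_error:
  fixes f :: "complex \<Rightarrow> complex"
  assumes "0 < r" and hol: "f holomorphic_on ball b r"
    and bound: "\<And>w. w \<in> ball b r \<Longrightarrow> norm (f w) \<le> B"
    and h: "h \<noteq> 0" "norm h < r / 2"
  shows "norm ((f (b + h) - f b) / h - deriv f b) \<le> 2 * B / (r / 2)\<^sup>2 * norm h"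
proof -
  have hol_deriv: "(deriv ^^ i) f holomorphic_on ball b r" for i
    using hol by (simp add: holomorphic_higher_deriv)
  have second: "norm ((deriv ^^ 2) f w) \<le> 2 * B / (r / 2)\<^sup>2" if w: "w \<in> ball b (r / 2)" for w
  proof -
    have sub: "cball w (r / 2) \<subseteq> ball b r"
    proof
      fix t assume "t \<in> cball w (r / 2)"
      then show "t \<in> ball b r"
        using w dist_triangle[of b t w] by simp
    qed
    \<comment> \<open>Points of the half-radius ball leave room for a circle of radius
      \<open>r / 2\<close> inside \<open>ball b r\<close>, where \<open>B\<close> bounds
      \<open>f\<close>.\<close>
    have "norm ((deriv ^^ 2) f w) \<le> fact 2 * B / (r / 2) ^ 2"
    proof (rule Cauchy_inequality)
      show "f holomorphic_on ball w (r / 2)"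
        using hol sub by (meson ball_subset_cball holomorphic_on_subset order_trans)
      show "continuous_on (cball w (r / 2)) f"
        using hol sub by (meson holomorphic_on_imp_continuous_on holomorphic_on_subset)
      show "norm (f x) \<le> B" if "norm (w - x) = r / 2" for x
        using that sub by (intro bound) (auto simp: subset_iff dist_norm)
    qed (use \<open>0 < r\<close> in simp)
    then show ?thesis by simp
  qed
  \<comment> \<open>The complex remainder estimate of order 1 divides by \<open>fact 1\<close>, not
    \<open>fact 2\<close>, so the factor 2 from Cauchy's inequality survives in the
    constant.\<close>
  have "norm ((deriv ^^ 0) f (b + h) - (\<Sum>i\<le>1. (deriv ^^ i) f b * (b + h - b) ^ i / fact i))
      \<le> 2 * B / (r / 2)\<^sup>2 * norm (b + h - b) ^ Suc 1 / fact 1"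
  proof (rule complex_Taylor[where S = "ball b (r / 2)"])
    show "((deriv ^^ i) f has_field_derivative (deriv ^^ Suc i) f w) (at w within ball b (r / 2))"
      if "w \<in> ball b (r / 2)" for i w
    proof -
      have "w \<in> ball b r" using that \<open>0 < r\<close> by auto
      then show ?thesis
        using holomorphic_derivI[OF hol_deriv[of i] open_ball] by simp
    qed
  qed (use second h \<open>0 < r\<close> in \<open>auto simp: dist_norm numeral_2_eq_2\<close>)
  then have taylor: "norm (f (b + h) - f b - deriv f b * h) \<le> 2 * B / (r / 2)\<^sup>2 * norm h * norm h"
    by (simp add: power2_eq_square algebra_simps)
  have "(f (b + h) - f b) / h - deriv f b = (f (b + h) - f b - deriv f b * h) / h"
    using h by (simp add: field_simps)
  then show ?thesis
    using taylor h by (simp add: norm_divide divide_le_eq)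
qed

text \<open>The quotients \<open>q h\<close> in the second variable are holomorphic in the first and
  converge uniformly near \<open>a\<close>. So their derivatives \<open>q' h\<close> converge to the
  derivative of the limit, and this one limit serves as both mixed partials.\<close>

lemma mixed_partials_separately_holomorphic:
  fixes f :: "complex \<Rightarrow> complex \<Rightarrow> complex"
  assumes r: "0 < r"
    and hol1: "\<And>w. w \<in> ball b r \<Longrightarrow> (\<lambda>z. f z w) holomorphic_on ball a r"
    and hol2: "\<And>z. z \<in> ball a r \<Longrightarrow> f z holomorphic_on ball b r"
    and bound: "\<And>z w. z \<in> ball a r \<Longrightarrow> w \<in> ball b r \<Longrightarrow> norm (f z w) \<le> B"
  obtains D where "((\<lambda>z. deriv (f z) b) has_field_derivative D) (at a)"
    "((\<lambda>w. deriv (\<lambda>z. f z w) a) has_field_derivative D) (at b)"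
proof -
  define q where "q h z = (f z (b + h) - f z b) / h" for h z
  define q' where "q' h z = (deriv (\<lambda>z. f z (b + h)) z - deriv (\<lambda>z. f z b) z) / h" for h z
  have small: "\<forall>\<^sub>F h in at 0. h \<noteq> 0 \<and> norm h < \<delta>" if "0 < \<delta>" for \<delta> :: real
    unfolding eventually_at by (rule exI[of _ \<delta>]) (use that in auto)
  have regular: "\<forall>\<^sub>F h in at 0. continuous_on (cball a (r / 2)) (q h) \<and>
      (\<forall>z\<in>ball a (r / 2). (q h has_field_derivative q' h z) (at z))"
    using small[OF r]
  proof eventually_elim
    case (elim h)
    then have bh: "b + h \<in> ball b r" "b \<in> ball b r"
      using r by (auto simp: dist_norm)
    have "q h holomorphic_on ball a r"
      unfolding q_def using hol1[OF bh(1)] hol1[OF bh(2)] elim by (intro holomorphic_intros) auto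
    then have "continuous_on (cball a (r / 2)) (q h)"
      by (rule holomorphic_on_imp_continuous_on[OF holomorphic_on_subset]) (use r in auto)
    moreover have "(q h has_field_derivative q' h z) (at z)" if "z \<in> ball a (r / 2)" for z
    proof -
      have z: "z \<in> ball a r" using that r by auto
      show ?thesis
        unfolding q_def q'_def
        using holomorphic_derivI[OF hol1[OF bh(1)] open_ball z]
          holomorphic_derivI[OF hol1[OF bh(2)] open_ball z]
        by (intro DERIV_cdivide DERIV_diff)
    qed
    ultimately show ?case by blast
  qed
  have uniform: "uniform_limit (cball a (r / 2)) q (\<lambda>z. deriv (f z) b) (at 0)"
  proof (rule uniform_limitI)
    fix e :: real assume "0 < e"
    define C where "C = 2 * B / (r / 2)\<^sup>2"
    have "0 \<le> B"
      using bound[of a b] r by (smt (verit) centre_in_ball norm_ge_zero)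
    then have "0 \<le> C" by (simp add: C_def)
    \<comment> \<open>\<open>r / 2\<close> is the range of \<open>h\<close> in the error estimate;
      the 1 in \<open>C + 1\<close> keeps the quotient meaningful when \<open>C = 0\<close>.\<close>
    then have "0 < min (r / 2) (e / (C + 1))"
      using \<open>0 < e\<close> r by simp
    from small[OF this]
    show "\<forall>\<^sub>F h in at 0. \<forall>z\<in>cball a (r / 2). dist (q h z) (deriv (f z) b) < e"
    proof eventually_elim
      case (elim h)
      show ?case
      proof
        fix z assume "z \<in> cball a (r / 2)"
        then have z: "z \<in> ball a r" using r by auto
        have "dist (q h z) (deriv (f z) b) \<le> C * norm h"
          unfolding q_def C_def dist_norm
          using elim by (intro difference_quotient_error[OF r hol2[OF z] bound[OF z]]) auto
        also have "\<dots> \<le> (C + 1) * norm h"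
          by (simp add: mult_right_mono)
        also have "\<dots> < e"
          using elim \<open>0 \<le> C\<close> by (simp add: less_divide_eq mult.commute)
        finally show "dist (q h z) (deriv (f z) b) < e" .
      qed
    qed
  qed
  have "0 < r / 2" using r by simp
  obtain g' where "\<And>z. z \<in> ball a (r / 2) \<Longrightarrow>
      ((\<lambda>z. deriv (f z) b) has_field_derivative g' z) (at z) \<and> ((\<lambda>h. q' h z) \<longlongrightarrow> g' z) (at 0)"
    using has_complex_derivative_uniform_limit[OF regular uniform _ \<open>0 < r / 2\<close>] by auto
  \<comment> \<open>At \<open>z = a\<close>, \<open>q' h a\<close> is itself the difference quotient
    at \<open>b\<close> of the partial derivative in the first variable, so its convergence is the
    second claim.\<close>
  from this[of a] show thesis
    using r by (intro that[of "g' a"]) (auto simp: DERIV_def q'_def)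
qed

section \<open>Slices and mixed partials in three variables\<close>

lemma holomorphic3_on_slices:
  assumes "holomorphic3_on f U" "open U" "(y, z, yb) \<in> U"
  shows "(\<lambda>t. f (y, t, yb)) field_differentiable at z"
    and "(\<lambda>t. f (y, z, t)) field_differentiable at yb"
proof -
  obtain a b c
    where der: "(f has_derivative (\<lambda>(h, k, l). a * h + b * k + c * l)) (at (y, z, yb))"
    using assms unfolding holomorphic3_on_def by (metis at_within_open)
  have "((\<lambda>t. f (y, t, yb)) has_derivative (\<lambda>k. (\<lambda>(h, k, l). a * h + b * k + c * l) (0, k, 0))) (at z)"
    by (rule has_derivative_compose[of "\<lambda>t. (y, t, yb)" _ _ _ f])
      (auto intro!: derivative_eq_intros der)
  then have "((\<lambda>t. f (y, t, yb)) has_field_derivative b) (at z)"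
    by (simp add: has_field_derivative_def)
  then show "(\<lambda>t. f (y, t, yb)) field_differentiable at z"
    by (auto simp: field_differentiable_def)
  have "((\<lambda>t. f (y, z, t)) has_derivative (\<lambda>l. (\<lambda>(h, k, l). a * h + b * k + c * l) (0, 0, l))) (at yb)"
    by (rule has_derivative_compose[of "\<lambda>t. (y, z, t)" _ _ _ f])
      (auto intro!: derivative_eq_intros der)
  then have "((\<lambda>t. f (y, z, t)) has_field_derivative c) (at yb)"
    by (simp add: has_field_derivative_def)
  then show "(\<lambda>t. f (y, z, t)) field_differentiable at yb"
    by (auto simp: field_differentiable_def)
qed

lemma holomorphic3_on_imp_continuous_on: "holomorphic3_on f U \<Longrightarrow> continuous_on U f"
  unfolding holomorphic3_on_def continuous_on_eq_continuous_within
  by (meson has_derivative_continuous)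

text \<open>With \<open>y\<close> frozen this is the two-variable result; joint continuity supplies
  the local bound it requires.\<close>

lemma holomorphic3_on_mixed_partials:
  assumes f: "holomorphic3_on f U" and U: "open U" "(y, z, yb) \<in> U"
  obtains D where "((\<lambda>t. deriv (\<lambda>s. f (y, t, s)) yb) has_field_derivative D) (at z)"
    "((\<lambda>s. deriv (\<lambda>t. f (y, t, s)) z) has_field_derivative D) (at yb)"
proof -
  \<comment> \<open>On \<open>S\<close>, open by continuity, \<open>f\<close> is bounded by its norm
    at the centre plus 1.\<close>
  define S where "S = U \<inter> f -` ball 0 (norm (f (y, z, yb)) + 1)"
  have "open S" "(y, z, yb) \<in> S"
    using U continuous_on_open_vimage[OF U(1)] holomorphic3_on_imp_continuous_on[OF f]
    by (auto simp: S_def Int_commute)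
  then obtain e where e: "0 < e" "ball (y, z, yb) e \<subseteq> S"
    by (meson open_contains_ball)
  \<comment> \<open>Radius \<open>e / 2\<close> in each variable fits a bidisc into the ball, as the
    product distance is at most the sum of the component distances.\<close>
  have inS: "(y, t, s) \<in> S" if "t \<in> ball z (e / 2)" "s \<in> ball yb (e / 2)" for t s
  proof -
    have "dist (y, z, yb) (y, t, s) \<le> dist z t + dist yb s"
      by (simp add: dist_Pair_Pair sqrt_sum_squares_le_sum)
    also have "\<dots> < e" using that by simp
    finally show ?thesis using e(2) by auto
  qed
  then have inU: "(y, t, s) \<in> U" if "t \<in> ball z (e / 2)" "s \<in> ball yb (e / 2)" for t s
    using that by (auto simp: S_def)
  show thesis
  proof (rule mixed_partials_separately_holomorphic[of "e / 2" yb "\<lambda>t s. f (y, t, s)" z])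
    show "(\<lambda>t. f (y, t, s)) holomorphic_on ball z (e / 2)" if "s \<in> ball yb (e / 2)" for s
      using holomorphic3_on_slices(1)[OF f U(1)] inU that
      by (auto simp: holomorphic_on_def intro: field_differentiable_at_within)
    show "(\<lambda>s. f (y, t, s)) holomorphic_on ball yb (e / 2)" if "t \<in> ball z (e / 2)" for t
      using holomorphic3_on_slices(2)[OF f U(1)] inU that
      by (auto simp: holomorphic_on_def intro: field_differentiable_at_within)
    show "norm (f (y, t, s)) \<le> norm (f (y, z, yb)) + 1"
      if "t \<in> ball z (e / 2)" "s \<in> ball yb (e / 2)" for t s
      using inS[OF that] by (simp add: S_def)
  qed (use e that in auto)
qed

section \<open>Closure properties of holomorphy\<close>

lemma holomorphic3_on_cong:
  assumes "\<And>p. p \<in> U \<Longrightarrow> f p = g p"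
  shows "holomorphic3_on f U \<longleftrightarrow> holomorphic3_on g U"
proof -
  have "(f has_derivative F) (at p within U) \<longleftrightarrow> (g has_derivative F) (at p within U)"
    if "p \<in> U" for F p
    using that assms has_derivative_transform[of p U f g] has_derivative_transform[of p U g f]
    by metis
  then show ?thesis by (simp add: holomorphic3_on_def)
qed

lemma holomorphic3_on_const: "holomorphic3_on (\<lambda>p. c) U"
  unfolding holomorphic3_on_def
proof (intro ballI exI)
  show "((\<lambda>p. c) has_derivative (\<lambda>(h, k, l). 0 * h + 0 * k + 0 * l)) (at p within U)" for p
    by (simp add: case_prod_unfold)
qed

lemma holomorphic3_on_add:
  assumes "holomorphic3_on f U" "holomorphic3_on g U"
  shows "holomorphic3_on (\<lambda>p. f p + g p) U"
  unfolding holomorphic3_on_def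
proof
  fix p assume "p \<in> U"
  with assms obtain a b c a' b' c'
    where f: "(f has_derivative (\<lambda>(h, k, l). a * h + b * k + c * l)) (at p within U)"
      and g: "(g has_derivative (\<lambda>(h, k, l). a' * h + b' * k + c' * l)) (at p within U)"
    unfolding holomorphic3_on_def by blast
  have "((\<lambda>p. f p + g p) has_derivative
      (\<lambda>(h, k, l). (a + a') * h + (b + b') * k + (c + c') * l)) (at p within U)"
    by (rule has_derivative_eq_rhs[OF has_derivative_add[OF f g]])
      (auto simp: fun_eq_iff algebra_simps)
  then show "\<exists>a b c. ((\<lambda>p. f p + g p) has_derivative (\<lambda>(h, k, l). a * h + b * k + c * l))
      (at p within U)" by blast
qed

lemma holomorphic3_on_mult:
  assumes "holomorphic3_on f U" "holomorphic3_on g U"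
  shows "holomorphic3_on (\<lambda>p. f p * g p) U"
  unfolding holomorphic3_on_def
proof
  fix p assume "p \<in> U"
  with assms obtain a b c a' b' c'
    where f: "(f has_derivative (\<lambda>(h, k, l). a * h + b * k + c * l)) (at p within U)"
      and g: "(g has_derivative (\<lambda>(h, k, l). a' * h + b' * k + c' * l)) (at p within U)"
    unfolding holomorphic3_on_def by blast
  have "((\<lambda>p. f p * g p) has_derivative (\<lambda>(h, k, l). (f p * a' + a * g p) * h
      + (f p * b' + b * g p) * k + (f p * c' + c * g p) * l)) (at p within U)"
    by (rule has_derivative_eq_rhs[OF has_derivative_mult[OF f g]])
      (auto simp: fun_eq_iff algebra_simps)
  then show "\<exists>a b c. ((\<lambda>p. f p * g p) has_derivative (\<lambda>(h, k, l). a * h + b * k + c * l))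
      (at p within U)" by blast
qed

lemma holomorphic3_on_sum:
  "(\<And>i. i \<in> A \<Longrightarrow> holomorphic3_on (f i) U) \<Longrightarrow> holomorphic3_on (\<lambda>p. \<Sum>i\<in>A. f i p) U"
  by (induction A rule: infinite_finite_induct)
    (simp_all add: holomorphic3_on_const holomorphic3_on_add)

lemma holomorphic3_on_prod:
  "(\<And>i. i \<in> A \<Longrightarrow> holomorphic3_on (f i) U) \<Longrightarrow> holomorphic3_on (\<lambda>p. \<Prod>i\<in>A. f i p) U"
  by (induction A rule: infinite_finite_induct)
    (simp_all add: holomorphic3_on_const holomorphic3_on_mult)

section \<open>Determinants, Cramer's rule and holomorphy of the potential\<close>

lemma holomorphic3_on_det:
  fixes M :: "('n::finite) mfield"
  assumes "mfield_holomorphic_on M U"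
  shows "holomorphic3_on (\<lambda>p. det (M p)) U"
  unfolding det_def using assms
  by (intro holomorphic3_on_sum holomorphic3_on_mult holomorphic3_on_prod holomorphic3_on_const)
    (simp add: mfield_holomorphic_on_def)

text \<open>Column \<open>j\<close> of the product solves the linear system with matrix
  \<open>A\<close> and right-hand side column \<open>j\<close> of \<open>B\<close>, so Cramer's rule
  gives its entries.\<close>

lemma matrix_inv_mult_cramer:
  fixes A B :: "complex ^ ('n::finite) ^ 'n"
  assumes "det A \<noteq> 0"
  shows "(matrix_inv A ** B) $ i $ j
    = det (\<chi> k l. if l = i then B $ k $ j else A $ k $ l) / det A"
proof -
  have "invertible A" using assms by (simp add: invertible_det_nz)
  \<comment> \<open>\<open>matrix_inv\<close> is defined by choice; invertibility provides the
    witness.\<close>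
  then have "A ** matrix_inv A = mat 1"
    unfolding matrix_inv_def invertible_def by (rule someI2_ex) blast
  then have "A ** (matrix_inv A ** B) = B"
    by (simp add: matrix_mul_assoc)
  moreover have "column j (A ** (matrix_inv A ** B)) = A *v column j (matrix_inv A ** B)"
    by (simp add: vec_eq_iff column_def matrix_vector_mult_def matrix_matrix_mult_def)
  ultimately have "A *v column j (matrix_inv A ** B) = column j B"
    by simp
  then have "column j (matrix_inv A ** B)
      = (\<chi> i. det (\<chi> k l. if l = i then column j B $ k else A $ k $ l) / det A)"
    by (simp add: cramer[OF assms])
  from arg_cong[OF this, of "\<lambda>v. v $ i"] show ?thesis
    unfolding column_def vec_lambda_beta .
qed

text \<open>Since \<open>det (J p) = 1\<close>, the denominator in Cramer's rule disappears and each
  entry is a polynomial in the entries of \<open>J\<close> and \<open>M\<close>.\<close>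

lemma inv_mult_holomorphic:
  fixes J M :: "('n::finite) mfield"
  assumes J: "mfield_holomorphic_on J U" "SL_valued U J" and M: "mfield_holomorphic_on M U"
  shows "mfield_holomorphic_on (inv_mult J M) U"
  unfolding mfield_holomorphic_on_def
proof (intro allI)
  fix i j
  define C :: "'n mfield" where "C p = (\<chi> k l. if l = i then M p $ k $ j else J p $ k $ l)" for p
  have "mfield_holomorphic_on C U"
    unfolding mfield_holomorphic_on_def
  proof (intro allI)
    show "holomorphic3_on (\<lambda>p. C p $ k $ l) U" for k l
      using J(1) M by (cases "l = i") (simp_all add: mfield_holomorphic_on_def C_def)
  qed
  then have "holomorphic3_on (\<lambda>p. det (C p)) U"
    by (rule holomorphic3_on_det)
  moreover have "inv_mult J M p $ i $ j = det (C p)" if "p \<in> U" for p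
    using matrix_inv_mult_cramer[of "J p" "M p" i j] J(2) that
    by (simp add: SL_valued_def inv_mult_def C_def)
  ultimately show "holomorphic3_on (\<lambda>p. inv_mult J M p $ i $ j) U"
    using holomorphic3_on_cong by (metis (no_types, lifting))
qed

section \<open>Total derivatives and the cancellation\<close>

text \<open>The recursion holds only on \<open>U\<close>. Openness keeps nearby points of the slice
  in \<open>U\<close>, so it may be used under an outer derivative.\<close>

lemma D_z_cong:
  assumes "open U" "p \<in> U" "\<And>q. q \<in> U \<Longrightarrow> M q = M' q"
  shows "D_z M p = D_z M' p"
proof -
  obtain y z yb where p: "p = (y, z, yb)" by (cases p)
  have "\<forall>\<^sub>F t in nhds z. (y, t, yb) \<in> U"
    by (rule eventually_nhds_in_open[of "(\<lambda>t. (y, t, yb)) -` U", simplified])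
      (use assms p in \<open>auto intro!: open_vimage continuous_intros\<close>)
  then have "deriv (\<lambda>t. M (y, t, yb) $ i $ j) z = deriv (\<lambda>t. M' (y, t, yb) $ i $ j) z" for i j
    by (intro deriv_cong_ev) (auto elim!: eventually_mono simp: assms(3))
  then show ?thesis by (simp add: D_z_def p)
qed

lemma D_yb_cong:
  assumes "open U" "p \<in> U" "\<And>q. q \<in> U \<Longrightarrow> M q = M' q"
  shows "D_yb M p = D_yb M' p"
proof -
  obtain y z yb where p: "p = (y, z, yb)" by (cases p)
  have "\<forall>\<^sub>F t in nhds yb. (y, z, t) \<in> U"
    by (rule eventually_nhds_in_open[of "(\<lambda>t. (y, z, t)) -` U", simplified])
      (use assms p in \<open>auto intro!: open_vimage continuous_intros\<close>)
  then have "deriv (\<lambda>t. M (y, z, t) $ i $ j) yb = deriv (\<lambda>t. M' (y, z, t) $ i $ j) yb" for i j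
    by (intro deriv_cong_ev) (auto elim!: eventually_mono simp: assms(3))
  then show ?thesis by (simp add: D_yb_def p)
qed

text \<open>Entry by entry, the two terms are \<open>D\<close> and \<open>- D\<close> for the common
  mixed partial \<open>D\<close>. The sign stands inside the outer derivative to match the second
  recursion relation.\<close>

lemma D_yb_D_z_cancel:
  fixes M :: "('n::finite) mfield"
  assumes M: "mfield_holomorphic_on M U" and U: "open U" "p \<in> U"
  shows "D_yb (D_z M) p + D_z (\<lambda>q. - D_yb M q) p = 0"
proof -
  obtain y z yb where p: "p = (y, z, yb)" by (cases p)
  have "deriv (\<lambda>s. deriv (\<lambda>t. M (y, t, s) $ i $ j) z) yb
      + deriv (\<lambda>t. - deriv (\<lambda>s. M (y, t, s) $ i $ j) yb) z = 0" for i j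
  proof -
    have "holomorphic3_on (\<lambda>p. M p $ i $ j) U"
      using M by (simp add: mfield_holomorphic_on_def)
    then obtain D
      where "((\<lambda>t. deriv (\<lambda>s. M (y, t, s) $ i $ j) yb) has_field_derivative D) (at z)"
        and "((\<lambda>s. deriv (\<lambda>t. M (y, t, s) $ i $ j) z) has_field_derivative D) (at yb)"
      by (rule holomorphic3_on_mixed_partials[OF _ U(1) U(2)[unfolded p]])
    then show ?thesis
      by (simp add: DERIV_imp_deriv DERIV_imp_deriv[OF DERIV_minus])
  qed
  then show ?thesis
    by (simp add: p D_yb_def D_z_def vec_eq_iff)
qed

theorem mainTheorem3:
  fixes U :: "point set" and J :: "('n::finite) mfield" and Q :: "int \<Rightarrow> 'n mfield"
  assumes "open U"
    and "sdym3_solution U J"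
    and "SL_valued U J"
    and "\<And>n. mfield_holomorphic_on (Q n) U"
    and "\<And>n p. p \<in> U \<Longrightarrow> cov_y J (inv_mult J (Q n)) p = D_z (inv_mult J (Q (n + 1))) p"
    and "\<And>n p. p \<in> U \<Longrightarrow> cov_z J (inv_mult J (Q n)) p = - D_yb (inv_mult J (Q (n + 1))) p"
  shows "\<forall>n. (\<forall>p\<in>U. sdym3_lin J (inv_mult J (Q n)) p = 0)
      \<and> (\<forall>p\<in>U. D_yb (cov_y J (inv_mult J (Q n))) p + D_z (cov_z J (inv_mult J (Q n))) p = 0)
      \<and> symmetry_characteristic U J (Q n)"
proof -
  have "sdym3_lin J (inv_mult J (Q n)) p = 0" if p: "p \<in> U" for n p
  proof -
    \<comment> \<open>The potential for level \<open>n\<close> sits at level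
      \<open>n + 1\<close>.\<close>
    have "mfield_holomorphic_on (inv_mult J (Q (n + 1))) U"
      using assms(2-4) by (intro inv_mult_holomorphic) (simp_all add: sdym3_solution_def)
    from D_yb_D_z_cancel[OF this assms(1) p] show ?thesis
      using D_yb_cong[OF assms(1) p assms(5)[of _ n]] D_z_cong[OF assms(1) p assms(6)[of _ n]]
      by (simp add: sdym3_lin_def)
  qed
  then show ?thesis
    using assms(2,4) by (simp add: symmetry_characteristic_def sdym3_lin_def)
qed

end
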